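(* Let $a_1,a_2,a_4,a_5\in\mathbb{C}$ and $$V=a_1q_1^3+a_2q_1^2q_2+a_4q_1q_2^2+a_5q_2^3+(q_1+\mathrm{i}q_2)^2q_3 .$$ If $V$ has exactly four proper Darboux points $[d_i]\in\mathbb{CP}^2$, $i=1,\dots,4$, all of them simple, with spectra $(\Lambda_1^{(i)},\Lambda_2^{(i)})$, then $$\sum_{i=1}^4\frac{1}{\Lambda_1^{(i)}\Lambda_2^{(i)}}=1,\qquad \sum_{i=1}^4\frac{\Lambda_1^{(i)}+\Lambda_2^{(i)}}{\Lambda_1^{(i)}\Lambda_2^{(i)}}=-4,\qquad \sum_{i=1}^4\frac{(\Lambda_1^{(i)}+\Lambda_2^{(i)})^2}{\Lambda_1^{(i)}\Lambda_2^{(i)}}=8 .$$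
   Context: For a homogeneous cubic $V\in\mathbb{C}[q_1,q_2,q_3]$, with $V'=\operatorname{grad}V$ and Hessian $V''$: a point $[d]\in\mathbb{CP}^2$ is a Darboux point of $V$ if $d\neq 0$ and $d\wedge V'(d)=0$; it is proper if $V'(d)\neq0$. For a proper Darboux point the representative $d$ is always chosen so that $V'(d)=d$. Then $d$ is an eigenvector of $V''(d)$ with (trivial) eigenvalue $2$; if $\lambda_1,\lambda_2,2$ are the eigenvalues of $V''(d)$ counted with multiplicity, the spectrum of $[d]$ is the unordered pair $(\Lambda_1,\Lambda_2)=(\lambda_1-1,\lambda_2-1)$. A Darboux point is simple if it is an isolated point of multiplicity one of the projective algebraic set defined by the polynomials $q_i\partial V/\partial q_j-q_j\partial V/\partial q_i$; for a proper Darboux point this is equivalent to $\Lambda_1\Lambda_2\neq0$. *)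

theory Defs
  imports "HOL-Analysis.Analysis" "HOL-Computational_Algebra.Computational_Algebra"
    "HOL-Library.Extended_Nat"
begin

text \<open>
  Elements of \<open>\<complex>[q\<^sub>1,\<dots>,q\<^sub>n]\<close> are represented by the polynomial functions they induce on
  \<open>\<complex>\<^sup>n\<close>; as \<open>\<complex>\<close> is infinite, this loses no information.
\<close>

definition partial_deriv :: "'n::finite \<Rightarrow> (complex^'n \<Rightarrow> complex) \<Rightarrow> complex^'n \<Rightarrow> complex" where
  "partial_deriv i f q = deriv (\<lambda>t. f (q + axis i t)) 0"

definition grad :: "(complex^'n::finite \<Rightarrow> complex) \<Rightarrow> complex^'n \<Rightarrow> complex^'n" where
  "grad V q = (\<chi> i. partial_deriv i V q)"

definition hessian :: "(complex^'n::finite \<Rightarrow> complex) \<Rightarrow> complex^'n \<Rightarrow> complex^'n^'n" where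
  "hessian V q = (\<chi> i j. partial_deriv i (partial_deriv j V) q)"

definition charpoly :: "complex^'n^'n::finite \<Rightarrow> complex poly" where
  "charpoly A = det (\<chi> i j. (if i = j then [:0, 1:] else 0) - [:A $ i $ j:])"

text \<open>The eigenvalues, each repeated according to its algebraic multiplicity.\<close>

definition eigenvalues :: "complex^'n^'n::finite \<Rightarrow> complex multiset" where
  "eigenvalues A = proots (charpoly A)"


text \<open>
  Darboux points. The point \<open>[d]\<close> of projective space is the punctured line through \<open>d\<close>, and
  \<open>d \<and> V'(d) = 0\<close> means that all \<open>2 \<times> 2\<close> minors of the pair \<open>d, V'(d)\<close> vanish.
\<close>

definition proj_point :: "complex^'n::finite \<Rightarrow> (complex^'n) set" where
  "proj_point d = {c *s d |c. c \<noteq> 0}"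

definition darboux_poly ::
    "(complex^'n::finite \<Rightarrow> complex) \<Rightarrow> 'n \<Rightarrow> 'n \<Rightarrow> complex^'n \<Rightarrow> complex" where
  "darboux_poly V i j q = q $ i * partial_deriv j V q - q $ j * partial_deriv i V q"

definition darboux_vector :: "(complex^'n::finite \<Rightarrow> complex) \<Rightarrow> complex^'n \<Rightarrow> bool" where
  "darboux_vector V d \<longleftrightarrow> d \<noteq> 0 \<and> (\<forall>i j. darboux_poly V i j d = 0)"

definition proper_darboux_points :: "(complex^'n::finite \<Rightarrow> complex) \<Rightarrow> (complex^'n) set set" where
  "proper_darboux_points V = {proj_point d |d. darboux_vector V d \<and> grad V d \<noteq> 0}"

text \<open>
  The spectrum of a proper Darboux point with representative \<open>d\<close> normalised by \<open>V'(d) = d\<close>: one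
  copy of the trivial eigenvalue \<open>2\<close> of \<open>V''(d)\<close> is dropped, the others are shifted by \<open>-1\<close>.
  For three variables this is a two-element multiset, that is, an unordered pair.
\<close>

definition darboux_spectrum ::
    "(complex^'n::finite \<Rightarrow> complex) \<Rightarrow> complex^'n \<Rightarrow> complex multiset" where
  "darboux_spectrum V d = image_mset (\<lambda>l. l - 1) (eigenvalues (hessian V d) - {#2#})"


text \<open>
  Multiplicity of a point \<open>p\<close> on the affine algebraic set (with its scheme structure) defined by a
  set \<open>S\<close> of polynomials: the dimension over \<open>\<complex>\<close> of \<open>\<O>\<^sub>p / S \<O>\<^sub>p\<close>, where \<open>\<O>\<^sub>p\<close> is the local ring of
  affine space at \<open>p\<close>.
\<close>

inductive polynomial_fun :: "(complex^'n::finite \<Rightarrow> complex) \<Rightarrow> bool" where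
  const: "polynomial_fun (\<lambda>x. c)"
| coord: "polynomial_fun (\<lambda>x. x $ i)"
| add: "polynomial_fun f \<Longrightarrow> polynomial_fun g \<Longrightarrow> polynomial_fun (\<lambda>x. f x + g x)"
| mult: "polynomial_fun f \<Longrightarrow> polynomial_fun g \<Longrightarrow> polynomial_fun (\<lambda>x. f x * g x)"

definition poly_ideal :: "(complex^'n::finite \<Rightarrow> complex) set \<Rightarrow> (complex^'n \<Rightarrow> complex) set" where
  "poly_ideal S = {f. \<exists>T h. finite T \<and> T \<subseteq> S \<and> (\<forall>s\<in>T. polynomial_fun (h s)) \<and>
                          f = (\<lambda>x. \<Sum>s\<in>T. h s x * s x)}"

text \<open>
  Fractions \<open>a/b\<close> with \<open>a \<in> M\<close> and \<open>b(p) \<noteq> 0\<close>. The values where \<open>b\<close> vanishes are left arbitrary,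
  so one fraction is represented by many functions. This does no harm in the quotient below: two
  representatives of a fraction differ by a function that vanishes on a Zariski neighbourhood of
  \<open>p\<close>, and such functions belong to \<open>localization p M\<close> for every ideal \<open>M\<close>.
\<close>

definition localization ::
    "complex^'n::finite \<Rightarrow> (complex^'n \<Rightarrow> complex) set \<Rightarrow> (complex^'n \<Rightarrow> complex) set" where
  "localization p M = {f. \<exists>a b. a \<in> M \<and> polynomial_fun b \<and> b p \<noteq> 0 \<and>
                             (\<forall>x. b x \<noteq> 0 \<longrightarrow> f x = a x / b x)}"

text \<open>
  The dimension of \<open>U / W\<close>, as the least size of a finite subset of \<open>U\<close> that spans \<open>U\<close> modulo \<open>W\<close>
  (infinite if there is none).
\<close>

definition quotient_dim :: "('a \<Rightarrow> complex) set \<Rightarrow> ('a \<Rightarrow> complex) set \<Rightarrow> enat" where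
  "quotient_dim U W =
     (INF B \<in> {B. finite B \<and> B \<subseteq> U \<and> (\<forall>u\<in>U. \<exists>c. (\<lambda>x. u x - (\<Sum>b\<in>B. c b * b x)) \<in> W)}.
        enat (card B))"

definition point_multiplicity ::
    "(complex^'n::finite \<Rightarrow> complex) set \<Rightarrow> complex^'n \<Rightarrow> enat" where
  "point_multiplicity S p =
     quotient_dim (localization p (Collect polynomial_fun)) (localization p (poly_ideal S))"

definition simple_point :: "(complex^'n::finite \<Rightarrow> complex) set \<Rightarrow> complex^'n \<Rightarrow> bool" where
  "simple_point S p \<longleftrightarrow> p isolated_in {x. \<forall>f\<in>S. f x = 0} \<and> point_multiplicity S p = 1"

text \<open>
  The projective algebraic set defined by the Darboux polynomials is examined near \<open>[d]\<close> in an
  affine chart \<open>q\<^sub>k = 1\<close> with \<open>d\<^sub>k \<noteq> 0\<close>, realised inside \<open>\<complex>\<^sup>n\<close> by adding the equation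
  \<open>q\<^sub>k - 1 = 0\<close>. The choice of \<open>k\<close> and of the representative \<open>d\<close> does not matter.
\<close>

definition simple_darboux :: "(complex^'n::finite \<Rightarrow> complex) \<Rightarrow> complex^'n \<Rightarrow> bool" where
  "simple_darboux V d \<longleftrightarrow> darboux_vector V d \<and>
     (\<exists>k. d $ k \<noteq> 0 \<and>
          simple_point (insert (\<lambda>q. q $ k - 1) {darboux_poly V i j |i j. True})
            (inverse (d $ k) *s d))"

end

theory Submission
  imports Defs
begin

text \<open>
  Put \<open>u = q\<^sub>1 + \<i> q\<^sub>2\<close>, \<open>w = q\<^sub>1 - \<i> q\<^sub>2\<close>, so that \<open>V = P(u, w) + u\<^sup>2 q\<^sub>3\<close> for a binary cubic
  \<open>P = b\<^sub>0 u\<^sup>3 + b\<^sub>1 u\<^sup>2 w + b\<^sub>2 u w\<^sup>2 + b\<^sub>3 w\<^sup>3\<close>. The solutions of \<open>V'(d) = d\<close> with \<open>u \<noteq> 0\<close> lie on the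
  rational curve \<open>w = t u\<close>, \<open>u = 1 / (2 B(t))\<close>, \<open>q\<^sub>3 = u\<^sup>2\<close>, and correspond to the roots of a
  polynomial \<open>F\<close>. If \<open>b\<^sub>3 \<noteq> 0\<close> then \<open>F\<close> is a quintic and there are no further solutions, so four of
  them force a double root; there the velocity of the curve is fixed by \<open>V''(d)\<close>, hence tangent to
  the scheme of Darboux points, and the point is not simple. So \<open>b\<^sub>3 = 0\<close>, \<open>F\<close> is a cubic with three
  distinct roots, and there is one more point with \<open>u = 0\<close> and spectrum \<open>(1, -1)\<close>. At a root \<open>t\<close>
  of \<open>F\<close> one finds \<open>\<Lambda>\<^sub>1 \<Lambda>\<^sub>2 = F'(t) / B(t)\<^sup>2\<close> and \<open>\<Lambda>\<^sub>1 + \<Lambda>\<^sub>2 = - 4 b\<^sub>2 t / B(t)\<close>, so the three sums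
  are Euler-Jacobi sums of quadratic polynomials over the roots of \<open>F\<close>.
\<close>

no_notation fps_nth (infixl "$" 75)

subsection \<open>Simple points and tangent vectors\<close>

lemma polynomial_fun_differentiable:
  assumes "polynomial_fun f"
  shows "(\<lambda>t. f (p + t *s w)) field_differentiable at 0"
  using assms
proof induction
  case (coord i)
  have "((\<lambda>t. (p + t *s w) $ i) has_field_derivative w $ i) (at 0)"
    by (auto intro!: derivative_eq_intros)
  then show ?case
    unfolding field_differentiable_def by blast
qed (simp_all add: field_differentiable_add field_differentiable_mult field_differentiable_const)

text \<open>By the product rule, a combination of functions that vanish to first order at
  \<open>p\<close> along \<open>w\<close> does so too, whatever its polynomial coefficients; the
  quotient rule carries this over to fractions.\<close>

lemma localization_tangent:
  assumes "f \<in> localization p (poly_ideal S)"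
    and zero: "\<And>s. s \<in> S \<Longrightarrow> s p = 0"
    and tangent: "\<And>s. s \<in> S \<Longrightarrow> ((\<lambda>t. s (p + t *s w)) has_field_derivative 0) (at 0)"
  shows "f p = 0 \<and> ((\<lambda>t. f (p + t *s w)) has_field_derivative 0) (at 0)"
proof -
  obtain a b where a: "a \<in> poly_ideal S" and b: "polynomial_fun b" "b p \<noteq> 0"
    and f: "\<And>x. b x \<noteq> 0 \<Longrightarrow> f x = a x / b x"
    using assms(1) unfolding localization_def by blast
  obtain T h where T: "T \<subseteq> S" and h: "\<And>s. s \<in> T \<Longrightarrow> polynomial_fun (h s)"
    and a_eq: "a = (\<lambda>x. \<Sum>s\<in>T. h s x * s x)"
    using a unfolding poly_ideal_def by blast
  have "a p = 0"
    using T zero unfolding a_eq by (intro sum.neutral) auto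
  have "((\<lambda>t. h s (p + t *s w) * s (p + t *s w)) has_field_derivative 0) (at 0)" if s: "s \<in> T" for s
  proof -
    obtain D where D: "((\<lambda>t. h s (p + t *s w)) has_field_derivative D) (at 0)"
      using polynomial_fun_differentiable[OF h[OF s]] unfolding field_differentiable_def by blast
    show ?thesis
      using DERIV_mult[OF D tangent[of s]] zero[of s] T s by auto
  qed
  then have da: "((\<lambda>t. a (p + t *s w)) has_field_derivative 0) (at 0)"
    unfolding a_eq using DERIV_sum[of T "\<lambda>t s. h s (p + t *s w) * s (p + t *s w)" "\<lambda>_. 0" "at 0"] by simp
  obtain D where D: "((\<lambda>t. b (p + t *s w)) has_field_derivative D) (at 0)"
    using polynomial_fun_differentiable[OF b(1)] unfolding field_differentiable_def by blast
  have "((\<lambda>t. a (p + t *s w) / b (p + t *s w)) has_field_derivative 0) (at 0)"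
    using DERIV_divide[OF da D] b(2) \<open>a p = 0\<close> by simp
  \<comment> \<open>\<open>f\<close> agrees with \<open>a / b\<close> only where \<open>b\<close> is
    nonzero, so the derivative transfers only after \<open>b\<close> is known to be nonzero near
    \<open>p\<close> on the line.\<close>
  moreover have "eventually (\<lambda>t. b (p + t *s w) \<noteq> 0) (nhds 0)"
  proof -
    have "isCont (\<lambda>t. b (p + t *s w)) 0" using D DERIV_isCont by blast
    then have "((\<lambda>t. b (p + t *s w)) \<longlongrightarrow> b p) (nhds 0)"
      by (simp add: isCont_def tendsto_nhds_iff)
    then show ?thesis using b(2) tendsto_imp_eventually_ne by blast
  qed
  ultimately have "((\<lambda>t. f (p + t *s w)) has_field_derivative 0) (at 0)"
    by (subst DERIV_cong_ev[where g = "\<lambda>t. a (p + t *s w) / b (p + t *s w)"])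
      (auto elim!: eventually_mono simp: f)
  with \<open>a p = 0\<close> b f show ?thesis by simp
qed

text \<open>
  The value at \<open>p\<close> and the derivative along \<open>w\<close> are independent functionals on the local ring that
  both vanish on the ideal, so the quotient has dimension at least two.
\<close>

lemma simple_point_no_tangent:
  assumes "simple_point S p" and "w \<noteq> 0"
    and tangent: "\<And>s. s \<in> S \<Longrightarrow> ((\<lambda>t. s (p + t *s w)) has_field_derivative 0) (at 0)"
  shows False
proof -
  let ?U = "localization p (Collect polynomial_fun)" and ?W = "localization p (poly_ideal S)"
  have zero: "s p = 0" if "s \<in> S" for s
    using assms(1) that unfolding simple_point_def isolated_in_def by auto
  have "quotient_dim ?U ?W = 1"
    using assms(1) unfolding simple_point_def point_multiplicity_def by simp
  \<comment> \<open>A nonempty set in \<open>enat\<close> attains its infimum, so some spanning set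
    really has one element.\<close>
  then have "\<exists>B. finite B \<and> card B = 1 \<and> (\<forall>u\<in>?U. \<exists>c. (\<lambda>x. u x - (\<Sum>b\<in>B. c b * b x)) \<in> ?W)"
  proof -
    let ?X = "{B. finite B \<and> B \<subseteq> ?U \<and> (\<forall>u\<in>?U. \<exists>c. (\<lambda>x. u x - (\<Sum>b\<in>B. c b * b x)) \<in> ?W)}"
    have I: "Inf ((\<lambda>B. enat (card B)) ` ?X) = 1"
      using \<open>quotient_dim ?U ?W = 1\<close> unfolding quotient_dim_def .
    then have "(\<lambda>B. enat (card B)) ` ?X \<noteq> {}" unfolding Inf_enat_def by (simp split: if_splits)
    then obtain k where "k \<in> (\<lambda>B. enat (card B)) ` ?X" by blast
    from wellorder_InfI[OF this] have "1 \<in> (\<lambda>B. enat (card B)) ` ?X"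
      unfolding I .
    then show ?thesis by (auto simp: one_enat_def)
  qed
  then obtain b where b: "\<And>u. u \<in> ?U \<Longrightarrow> \<exists>c. (\<lambda>x. u x - c * b x) \<in> ?W"
    by (auto simp: card_1_singleton_iff) metis
  have poly: "u \<in> ?U" if "polynomial_fun u" for u
    unfolding localization_def using that polynomial_fun.const[of 1] by fastforce
  obtain i where i: "w $ i \<noteq> 0"
    using \<open>w \<noteq> 0\<close> by (auto simp: vec_eq_iff)
  \<comment> \<open>If \<open>b\<close> alone spans, then \<open>1\<close> is congruent to
    \<open>c * b\<close> and the \<open>i\<close>-th coordinate to \<open>e * b\<close>. Eliminating
    \<open>b\<close> leaves the coordinate minus \<open>e / c\<close> with derivative zero along
    \<open>w\<close>, although that derivative is \<open>w $ i\<close>.\<close>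
  obtain c where c: "(\<lambda>x. 1 - c * b x) \<in> ?W"
    using b[OF poly[OF polynomial_fun.const[of 1]]] by blast
  obtain e where e: "(\<lambda>x. x $ i - e * b x) \<in> ?W"
    using b[OF poly[OF polynomial_fun.coord[of i]]] by blast
  have c': "1 - c * b p = 0" "((\<lambda>t. 1 - c * b (p + t *s w)) has_field_derivative 0) (at 0)"
    using localization_tangent[where f = "\<lambda>x. 1 - c * b x", OF c] zero tangent by blast+
  have e': "((\<lambda>t. (p + t *s w) $ i - e * b (p + t *s w)) has_field_derivative 0) (at 0)"
    using localization_tangent[where f = "\<lambda>x. x $ i - e * b x", OF e] zero tangent by blast
  have "c \<noteq> 0" using c' by auto
  have "((\<lambda>t. (p + t *s w) $ i) has_field_derivative 0) (at 0)"
  proof -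
    have "((\<lambda>t. (p $ i + t * w $ i - e * b (p + t *s w)) - e / c * (1 - c * b (p + t *s w)))
        has_field_derivative 0 - e / c * 0) (at 0)"
      using c'(2) e' by (intro DERIV_diff DERIV_cmult) auto
    moreover have "(\<lambda>t. (p $ i + t * w $ i - e * b (p + t *s w)) - e / c * (1 - c * b (p + t *s w)))
       = (\<lambda>t. p $ i + t * w $ i - e / c)"
      using \<open>c \<noteq> 0\<close> by (auto simp: field_simps)
    ultimately have "((\<lambda>t. p $ i + t * w $ i - e / c) has_field_derivative 0) (at 0)" by simp
    from DERIV_add[OF this DERIV_const[of "e/c"]] show ?thesis by simp
  qed
  moreover have "((\<lambda>t. (p + t *s w) $ i) has_field_derivative w $ i) (at 0)"
    by (auto intro!: derivative_eq_intros)
  ultimately show False using i DERIV_unique by blast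
qed

text \<open>A vector \<open>w\<close> fixed by \<open>V''(d)\<close> is an infinitesimal solution:
  the linearisation of \<open>q \<and> V'(q)\<close> at \<open>d\<close> along \<open>w\<close> is
  \<open>w \<and> d + d \<and> w = 0\<close>. Subtracting a multiple of \<open>d\<close> keeps the
  direction in the affine chart.\<close>

lemma not_simple_darboux:
  fixes V :: "complex^'n \<Rightarrow> complex"
  assumes scale: "\<And>i c q. partial_deriv i V (c *s q) = c\<^sup>2 * partial_deriv i V q"
    and deriv: "\<And>i q w. ((\<lambda>t. partial_deriv i V (q + t *s w)) has_field_derivative
                   (hessian V q *v w) $ i) (at 0)"
    and d: "grad V d = d"
    and w: "hessian V d *v w = w" "w \<noteq> 0"
  shows "\<not> simple_darboux V d"
proof
  assume "simple_darboux V d"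
  then obtain k where k: "d $ k \<noteq> 0"
    and simple: "simple_point (insert (\<lambda>q. q $ k - 1) {darboux_poly V i j |i j. True})
            (inverse (d $ k) *s d)" (is "simple_point ?S ?p")
    unfolding simple_darboux_def by blast
  have V_d: "partial_deriv i V d = d $ i" for i
    using d by (simp add: grad_def vec_eq_iff)
  have deriv': "((\<lambda>t. partial_deriv i V (c *s d + t *s w')) has_field_derivative
                   c * (hessian V d *v w') $ i) (at 0)" if "c \<noteq> 0" for i c w'
  proof -
    have "((\<lambda>t. c\<^sup>2 * partial_deriv i V (d + (t / c) *s w')) has_field_derivative
       c\<^sup>2 * ((hessian V d *v w') $ i * (1 / c))) (at 0)"
      by (intro DERIV_cmult DERIV_chain'[where f = "\<lambda>t. t / c" and g = "\<lambda>t. partial_deriv i V (d + t *s w')"])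
        (use deriv that in \<open>auto intro!: derivative_eq_intros\<close>)
    moreover have "c\<^sup>2 * partial_deriv i V (d + (t / c) *s w') = partial_deriv i V (c *s d + t *s w')" for t
      using that by (simp add: scale[symmetric] vector_add_ldistrib vector_smult_assoc)
    ultimately show ?thesis
      using that by (simp add: power2_eq_square)
  qed
  \<comment> \<open>Euler's relation for the quadratic map \<open>V'\<close>, obtained by
    differentiating \<open>(1 + t)^2 d\<close> at \<open>t = 0\<close>.\<close>
  have euler: "hessian V d *v d = 2 *s d"
  proof -
    have "(hessian V d *v d) $ i = 2 * d $ i" for i
    proof (rule DERIV_unique)
      show "((\<lambda>t. partial_deriv i V (d + t *s d)) has_field_derivative (hessian V d *v d) $ i) (at 0)"
        by (rule deriv)
      have "d + t *s d = (1 + t) *s d" for t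
        by (simp add: vector_sadd_rdistrib)
      then have "(\<lambda>t. partial_deriv i V (d + t *s d)) = (\<lambda>t. (1 + t)\<^sup>2 * d $ i)"
        by (simp only: scale V_d)
      then show "((\<lambda>t. partial_deriv i V (d + t *s d)) has_field_derivative 2 * d $ i) (at 0)"
        by (auto intro!: derivative_eq_intros)
    qed
    then show ?thesis by (simp add: vec_eq_iff)
  qed
  \<comment> \<open>Chosen so that \<open>w'\<close> has \<open>k\<close>-th coordinate zero, hence
    is tangent to the chart \<open>q $ k = 1\<close>.\<close>
  define e where "e = w $ k / d $ k"
  define w' where "w' = w - e *s d"
  have Hw': "hessian V d *v w' = w - (2 * e) *s d"
    by (simp add: w'_def matrix_vector_mult_diff_distrib vector_scalar_commute w euler
        vector_smult_assoc mult.commute)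
  \<comment> \<open>\<open>w\<close> is not a multiple of \<open>d\<close>, because they belong to
    the distinct eigenvalues \<open>1\<close> and \<open>2\<close>.\<close>
  have "w' \<noteq> 0"
  proof
    assume "w' = 0"
    then have "w = e *s d" "w = (2 * e) *s d"
      using Hw' by (simp_all add: w'_def)
    then have "w = w + w" by (metis mult_2 vector_sadd_rdistrib)
    then show False using \<open>w \<noteq> 0\<close> by simp
  qed
  moreover have "((\<lambda>t. s (?p + t *s w')) has_field_derivative 0) (at 0)" if "s \<in> ?S" for s
    using that
  proof
    assume "s = (\<lambda>q. q $ k - 1)"
    moreover have "w' $ k = 0" using k by (simp add: w'_def e_def)
    ultimately show ?thesis by simp
  next
    assume "s \<in> {darboux_poly V i j |i j. True}"
    then obtain i j where s: "s = darboux_poly V i j" by blast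
    define c where "c = inverse (d $ k)"
    have "c \<noteq> 0" using k by (simp add: c_def)
    have lin: "((\<lambda>t. (c *s d + t *s w') $ i) has_field_derivative w' $ i) (at 0)" for i
      by (auto intro!: derivative_eq_intros)
    show ?thesis
      unfolding s darboux_poly_def c_def[symmetric]
      by (rule DERIV_cong[OF DERIV_diff[OF DERIV_mult[OF lin deriv'[OF \<open>c \<noteq> 0\<close>]]
              DERIV_mult[OF lin deriv'[OF \<open>c \<noteq> 0\<close>]]]])
        (simp add: Hw' scale V_d, simp add: w'_def algebra_simps power2_eq_square)
  qed
  ultimately show False
    using simple_point_no_tangent[OF simple] by blast
qed

text \<open>Each line of a proper Darboux point carries only one normalised vector: since
  \<open>V'\<close> is quadratic, \<open>d\<close> and \<open>c *s d\<close> are both normalised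
  only if \<open>c^2 = c\<close>. Counting projective points thus becomes counting nonzero solutions
  of \<open>V'(q) = q\<close>.\<close>

lemma bij_betw_normalised:
  fixes V :: "complex^'n \<Rightarrow> complex"
  assumes scale: "\<And>i c q. partial_deriv i V (c *s q) = c\<^sup>2 * partial_deriv i V q"
    and bij: "bij_betw (\<lambda>i. proj_point (d i)) I (proper_darboux_points V)"
    and normalised: "\<And>i. i \<in> I \<Longrightarrow> grad V (d i) = d i"
  shows "bij_betw d I {q. grad V q = q \<and> q \<noteq> 0}"
  unfolding bij_betw_def
proof
  show "inj_on d I"
    using bij unfolding bij_betw_def by (auto simp: inj_on_def)
  have self: "q \<in> proj_point q" for q :: "complex^'n"
    unfolding proj_point_def by (auto intro!: exI[of _ 1])
  \<comment> \<open>The equation \<open>V'(d) = d\<close> also admits \<open>d = 0\<close>; this is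
    excluded because the zero vector gives the set \<open>{0}\<close>, whereas every Darboux point
    contains a nonzero vector.\<close>
  have nonzero: "d i \<noteq> 0" if i: "i \<in> I" for i
  proof
    assume "d i = 0"
    then have "proj_point (d i) = {0}" by (auto simp: proj_point_def intro!: exI[of _ 1])
    moreover have "proj_point (d i) \<in> proper_darboux_points V"
      using bij i unfolding bij_betw_def by blast
    then obtain q where "proj_point (d i) = proj_point q" "q \<noteq> 0"
      unfolding proper_darboux_points_def darboux_vector_def by blast
    ultimately show False using self[of q] by simp
  qed
  show "d ` I = {q. grad V q = q \<and> q \<noteq> 0}"
  proof (intro equalityI subsetI)
    fix q assume "q \<in> d ` I"
    then show "q \<in> {q. grad V q = q \<and> q \<noteq> 0}" using nonzero normalised by auto
  next
    fix q assume "q \<in> {q. grad V q = q \<and> q \<noteq> 0}"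
    then have q: "grad V q = q" "q \<noteq> 0" by auto
    then have "partial_deriv i V q = q $ i" for i by (simp add: grad_def vec_eq_iff)
    then have "darboux_vector V q"
      using q by (simp add: darboux_vector_def darboux_poly_def)
    then have "proj_point q \<in> proper_darboux_points V"
      using q unfolding proper_darboux_points_def by auto
    then obtain i where i: "i \<in> I" "proj_point q = proj_point (d i)"
      using bij unfolding bij_betw_def by blast
    then obtain c where c: "q = c *s d i"
      using self[of q] by (auto simp: proj_point_def)
    have "grad V q = c\<^sup>2 *s grad V (d i)"
      by (simp add: c grad_def scale vec_eq_iff)
    then have "c\<^sup>2 *s d i = c *s d i" using q normalised[OF i(1)] c by simp
    then have "c = 0 \<or> c = 1"
      using nonzero[OF i(1)] by (auto simp: power2_eq_square vec_eq_iff)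
    then have "c = 1" using c q by auto
    then show "q \<in> d ` I" using c i by simp
  qed
qed

subsection \<open>Spectra and root sums\<close>

text \<open>
  That \<open>2\<close> is an eigenvalue need not be assumed: otherwise nothing would be removed from the three
  eigenvalues, and the spectrum would have three elements.
\<close>

lemma darboux_spectrum_invariants:
  assumes "darboux_spectrum V q = {#x, y#}"
  shows "x * y = det (hessian V q - mat 1)" and "x + y = trace (hessian V q :: complex^3^3) - 4"
proof -
  define A where "A = hessian V q"
  have cp: "charpoly A = [:- det A,
      A$1$1 * A$2$2 + A$1$1 * A$3$3 + A$2$2 * A$3$3 - A$1$2 * A$2$1 - A$1$3 * A$3$1 - A$2$3 * A$3$2,
      - trace A, 1:]"
    by (simp add: charpoly_def det_3 trace_def sum_3 algebra_simps)
  then have "size (eigenvalues A) = 3"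
    by (simp add: eigenvalues_def size_proots_complex)
  have img: "image_mset (\<lambda>l. l - 1) (eigenvalues A - {#2#}) = {#x, y#}"
    using assms by (simp add: darboux_spectrum_def A_def)
  have "size (eigenvalues A - {#2#}) = 2"
    using arg_cong[OF img, of size] by simp
  then have "2 \<in># eigenvalues A"
    using \<open>size (eigenvalues A) = 3\<close> by (metis diff_single_trivial numeral_eq_iff semiring_norm(89))
  then have "eigenvalues A = add_mset 2 (eigenvalues A - {#2#})"
    by simp
  moreover have "eigenvalues A - {#2#} = {#x + 1, y + 1#}"
    using arg_cong[OF img, of "image_mset (\<lambda>l. l + 1)"] by (simp add: image_mset.compositionality o_def)
  ultimately have ev: "eigenvalues A = {#2, x + 1, y + 1#}" by simp
  have "charpoly A = [:- 2, 1:] * ([:- (x + 1), 1:] * [:- (y + 1), 1:])"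
    using complex_poly_decompose_multiset[of "charpoly A"] ev by (simp add: cp eigenvalues_def)
  note eq = this[unfolded cp]
  show "x + y = trace (hessian V q) - 4"
    using arg_cong[OF eq, of "\<lambda>p. coeff p 2"] by (simp add: A_def numeral_2_eq_2 algebra_simps)
  \<comment> \<open>At \<open>1\<close> the factorised polynomial is
    \<open>(1 - 2) * (- x) * (- y) = - x * y\<close>, and the characteristic polynomial is
    \<open>det (1 - A) = - det (A - 1)\<close> in dimension three.\<close>
  show "x * y = det (hessian V q - mat 1)"
    using arg_cong[OF eq, of "\<lambda>p. poly p 1"]
    by (simp add: A_def[symmetric] det_3 mat_def trace_def sum_3 algebra_simps)
qed

text \<open>All roots have order one, so counting with multiplicity is plain counting. Read
  contrapositively, too few distinct roots force a common root with the derivative.\<close>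

lemma card_roots_eq_degree:
  fixes p :: "complex poly"
  assumes "\<And>x. poly p x = 0 \<Longrightarrow> poly (pderiv p) x \<noteq> 0"
  shows "card {x. poly p x = 0} = degree p"
proof -
  have "rsquarefree p" using assms unfolding rsquarefree_roots by blast
  then have "p \<noteq> 0" and "\<And>x. poly p x = 0 \<Longrightarrow> order x p = 1"
    by (auto simp: rsquarefree_def order_root) (metis gr_implies_not0)
  then have "size (proots p) = card {x. poly p x = 0}"
    by (simp add: size_multiset_overloaded_eq)
  then show ?thesis by (simp add: size_proots_complex)
qed

text \<open>The denominators are the values of the derivative of
  \<open>k * (x - r) * (x - s) * (x - t)\<close> at its roots; by Lagrange interpolation the sum is
  the leading coefficient of the quadratic \<open>f\<close>, divided by \<open>k\<close>.\<close>

lemma euler_jacobi_3: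
  fixes k :: "'a::field"
  assumes "k \<noteq> 0" "r \<noteq> s" "r \<noteq> t" "s \<noteq> t"
    and "\<And>x. f x = \<alpha> + \<beta> * x + \<gamma> * x\<^sup>2"
  shows "f r / (k * (r - s) * (r - t)) + f s / (k * (s - r) * (s - t))
      + f t / (k * (t - r) * (t - s)) = \<gamma> / k"
proof -
  have "k * (s - r) * (s - t) = - (k * (r - s) * (s - t))"
    "k * (t - r) * (t - s) = k * (r - t) * (s - t)" by (simp_all add: algebra_simps)
  moreover have "r - s \<noteq> 0" "r - t \<noteq> 0" "s - t \<noteq> 0" using assms by auto
  moreover have "(\<alpha> + \<beta> * r + \<gamma> * r\<^sup>2) * (s - t) - (\<alpha> + \<beta> * s + \<gamma> * s\<^sup>2) * (r - t)
      + (\<alpha> + \<beta> * t + \<gamma> * t\<^sup>2) * (r - s) = \<gamma> * ((r - s) * ((r - t) * (s - t)))"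
    by (simp add: algebra_simps power2_eq_square)
  ultimately show ?thesis using assms(1)
    by (simp add: divide_simps assms(5))
qed

subsection \<open>Cubics of the form \<open>P(u, w) + u\<^sup>2 q\<^sub>3\<close>\<close>

locale null_cubic =
  fixes b0 b1 b2 b3 :: complex
begin

definition P :: "complex \<Rightarrow> complex \<Rightarrow> complex" where
  "P u v = b0 * u ^ 3 + b1 * u\<^sup>2 * v + b2 * u * v\<^sup>2 + b3 * v ^ 3"

definition Pu :: "complex \<Rightarrow> complex \<Rightarrow> complex" where
  "Pu u v = 3 * b0 * u\<^sup>2 + 2 * b1 * u * v + b2 * v\<^sup>2"

definition Pv :: "complex \<Rightarrow> complex \<Rightarrow> complex" where
  "Pv u v = b1 * u\<^sup>2 + 2 * b2 * u * v + 3 * b3 * v\<^sup>2"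

definition Puu :: "complex \<Rightarrow> complex \<Rightarrow> complex" where
  "Puu u v = 6 * b0 * u + 2 * b1 * v"

definition Puv :: "complex \<Rightarrow> complex \<Rightarrow> complex" where
  "Puv u v = 2 * b1 * u + 2 * b2 * v"

definition Pvv :: "complex \<Rightarrow> complex \<Rightarrow> complex" where
  "Pvv u v = 2 * b2 * u + 6 * b3 * v"

definition U :: "complex^3 \<Rightarrow> complex" where "U q = q $ 1 + \<i> * q $ 2"
definition W :: "complex^3 \<Rightarrow> complex" where "W q = q $ 1 - \<i> * q $ 2"

definition pot :: "complex^3 \<Rightarrow> complex" where
  "pot q = P (U q) (W q) + (U q)\<^sup>2 * q $ 3"

lemma U_add [simp]: "U (q + r) = U q + U r" and W_add [simp]: "W (q + r) = W q + W r"
  and U_scale [simp]: "U (c *s q) = c * U q" and W_scale [simp]: "W (c *s q) = c * W q"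
  and U_axis [simp]: "U (axis 1 t) = t" "U (axis 2 t) = \<i> * t" "U (axis 3 t) = 0"
  and W_axis [simp]: "W (axis 1 t) = t" "W (axis 2 t) = - \<i> * t" "W (axis 3 t) = 0"
  by (simp_all add: U_def W_def axis_def algebra_simps)

lemma axis_3 [simp]: "axis 1 (t::complex) $ (3::3) = 0" "axis 2 (t::complex) $ (3::3) = 0"
   "axis 3 (t::complex) $ (3::3) = t"
  by (simp_all add: axis_def)

section \<open>Gradient and Hessian of the cubic\<close>

lemma DERIV_P [derivative_intros]:
  assumes "(f has_field_derivative f') (at x)" "(g has_field_derivative g') (at x)"
  shows "((\<lambda>t. P (f t) (g t)) has_field_derivative Pu (f x) (g x) * f' + Pv (f x) (g x) * g') (at x)"
  unfolding P_def using assms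
  by (auto intro!: derivative_eq_intros simp: Pu_def Pv_def algebra_simps power2_eq_square power3_eq_cube)

lemma DERIV_Pu [derivative_intros]:
  assumes "(f has_field_derivative f') (at x)" "(g has_field_derivative g') (at x)"
  shows "((\<lambda>t. Pu (f t) (g t)) has_field_derivative Puu (f x) (g x) * f' + Puv (f x) (g x) * g') (at x)"
  unfolding Pu_def using assms
  by (auto intro!: derivative_eq_intros simp: Puu_def Puv_def algebra_simps power2_eq_square)

lemma DERIV_Pv [derivative_intros]:
  assumes "(f has_field_derivative f') (at x)" "(g has_field_derivative g') (at x)"
  shows "((\<lambda>t. Pv (f t) (g t)) has_field_derivative Puv (f x) (g x) * f' + Pvv (f x) (g x) * g') (at x)"
  unfolding Pv_def using assms
  by (auto intro!: derivative_eq_intros simp: Pvv_def Puv_def algebra_simps power2_eq_square)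

lemma partial_deriv_pot:
  "partial_deriv 1 pot = (\<lambda>q. Pu (U q) (W q) + Pv (U q) (W q) + 2 * U q * q $ 3)"
  "partial_deriv 2 pot = (\<lambda>q. \<i> * (Pu (U q) (W q) - Pv (U q) (W q) + 2 * U q * q $ 3))"
  "partial_deriv 3 pot = (\<lambda>q. (U q)\<^sup>2)"
  unfolding partial_deriv_def pot_def
  by (rule ext, rule DERIV_imp_deriv, auto intro!: derivative_eq_intros simp: algebra_simps)+

lemma hessian_pot:
  "hessian pot q $ 1 $ 1 = Puu (U q) (W q) + 2 * Puv (U q) (W q) + Pvv (U q) (W q) + 2 * q $ 3"
  "hessian pot q $ 1 $ 2 = \<i> * (Puu (U q) (W q) - Pvv (U q) (W q) + 2 * q $ 3)"
  "hessian pot q $ 2 $ 1 = \<i> * (Puu (U q) (W q) - Pvv (U q) (W q) + 2 * q $ 3)"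
  "hessian pot q $ 2 $ 2 = - (Puu (U q) (W q) - 2 * Puv (U q) (W q) + Pvv (U q) (W q) + 2 * q $ 3)"
  "hessian pot q $ 1 $ 3 = 2 * U q" "hessian pot q $ 3 $ 1 = 2 * U q"
  "hessian pot q $ 2 $ 3 = 2 * \<i> * U q" "hessian pot q $ 3 $ 2 = 2 * \<i> * U q"
  "hessian pot q $ 3 $ 3 = 0"
  unfolding hessian_def vec_lambda_beta partial_deriv_pot unfolding partial_deriv_def
  by (rule DERIV_imp_deriv, (auto intro!: derivative_eq_intros simp: algebra_simps)[1])+

lemma DERIV_partial_deriv_pot:
  "((\<lambda>t. partial_deriv i pot (q + t *s w)) has_field_derivative (hessian pot q *v w) $ i) (at 0)"
proof -
  have "((\<lambda>t. partial_deriv 1 pot (q + t *s w)) has_field_derivative (hessian pot q *v w) $ 1) (at 0)"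
    unfolding partial_deriv_pot
    by (auto intro!: derivative_eq_intros simp: matrix_vector_mult_def sum_3 hessian_pot)
      (simp add: U_def W_def algebra_simps)
  moreover
  have "((\<lambda>t. partial_deriv 2 pot (q + t *s w)) has_field_derivative (hessian pot q *v w) $ 2) (at 0)"
    unfolding partial_deriv_pot
    by (auto intro!: derivative_eq_intros simp: matrix_vector_mult_def sum_3 hessian_pot)
      (simp add: U_def W_def algebra_simps)
  moreover
  have "((\<lambda>t. partial_deriv 3 pot (q + t *s w)) has_field_derivative (hessian pot q *v w) $ 3) (at 0)"
    unfolding partial_deriv_pot
    by (auto intro!: derivative_eq_intros simp: matrix_vector_mult_def sum_3 hessian_pot)
      (simp add: U_def W_def algebra_simps)
  ultimately show ?thesis using exhaust_3[of i] by auto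
qed

lemma partial_deriv_pot_scale: "partial_deriv i pot (c *s q) = c\<^sup>2 * partial_deriv i pot q"
  using exhaust_3[of i]
  by (auto simp: partial_deriv_pot Pu_def Pv_def algebra_simps power2_eq_square)

lemma trace_hessian_pot: "trace (hessian pot q) = 4 * Puv (U q) (W q)"
  by (simp add: trace_def sum_3 hessian_pot)

lemma det_hessian_pot:
  "det (hessian pot q - mat 1) = 4 * Pvv (U q) (W q) * (Puu (U q) (W q) + 2 * q $ 3 + 4 * (U q)\<^sup>2)
      - (2 * Puv (U q) (W q) - 1)\<^sup>2"
  by (simp add: det_3 mat_def hessian_pot algebra_simps power2_eq_square)

text \<open>Solutions are the critical points of \<open>V - (u w + q\<^sub>3\<^sup>2) / 2\<close>,
  because \<open>q\<^sub>1\<^sup>2 + q\<^sub>2\<^sup>2 = u w\<close>. This explains the factors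
  \<open>1/2\<close> and why the \<open>u\<close>-derivative is paired with
  \<open>w\<close>.\<close>

lemma fixed_iff:
  "grad pot q = q \<longleftrightarrow> Pu (U q) (W q) + 2 * U q * q $ 3 = W q / 2 \<and> Pv (U q) (W q) = U q / 2
      \<and> q $ 3 = (U q)\<^sup>2" (is "_ \<longleftrightarrow> ?a = _ \<and> ?b = _ \<and> _")
proof -
  have "grad pot q = q \<longleftrightarrow> (?a + ?b = q $ 1 \<and> \<i> * (?a - ?b) = q $ 2) \<and> (U q)\<^sup>2 = q $ 3"
    by (simp add: vec_eq_iff forall_3 grad_def partial_deriv_pot algebra_simps)
  also have "?a + ?b = q $ 1 \<and> \<i> * (?a - ?b) = q $ 2 \<longleftrightarrow> ?a = W q / 2 \<and> ?b = U q / 2"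
  proof -
    have "a + b = x \<and> \<i> * (a - b) = y \<longleftrightarrow> a = (x - \<i> * y) / 2 \<and> b = (x + \<i> * y) / 2" for a b x y
    proof
      assume "a + b = x \<and> \<i> * (a - b) = y"
      then have "x = a + b" "y = \<i> * (a - b)" by auto
      moreover have "\<i> * y = b - a"
        unfolding \<open>y = _\<close> by (simp add: mult.assoc[symmetric])
      ultimately show "a = (x - \<i> * y) / 2 \<and> b = (x + \<i> * y) / 2" by simp
    next
      assume "a = (x - \<i> * y) / 2 \<and> b = (x + \<i> * y) / 2"
      then have ab: "a = (x - \<i> * y) / 2" "b = (x + \<i> * y) / 2" by auto
      show "a + b = x \<and> \<i> * (a - b) = y"
        unfolding ab by (simp add: field_simps)
    qed
    from this[of ?a ?b "q $ 1" "q $ 2"] show ?thesis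
      by (simp only: U_def[of q, symmetric] W_def[of q, symmetric])
  qed
  finally show ?thesis
    by (simp only: conj_assoc eq_commute[of "(U q)\<^sup>2"])
qed

section \<open>Solutions of \<open>V'(q) = q\<close> and the rational curve\<close>

definition pt :: "complex \<Rightarrow> complex \<Rightarrow> complex \<Rightarrow> complex^3" where
  "pt u v z = vector [(u + v) / 2, (u - v) / (2 * \<i>), z]"

lemma U_pt [simp]: "U (pt u v z) = u" and W_pt [simp]: "W (pt u v z) = v"
  and pt_3 [simp]: "pt u v z $ 3 = z"
  by (simp_all add: U_def W_def pt_def field_simps)

lemma pt_U_W: "pt (U q) (W q) (q $ 3) = q"
  by (simp add: U_def W_def pt_def vec_eq_iff forall_3)

lemma eq_iff_U_W: "q = r \<longleftrightarrow> U q = U r \<and> W q = W r \<and> q $ 3 = r $ 3"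
  by (metis pt_U_W)

text \<open>\<open>A\<close> and \<open>B\<close> are \<open>Pu\<close> and \<open>Pv\<close> at
  \<open>u = 1\<close>, \<open>v = t\<close>. \<open>F\<close> is the \<open>u\<close>-equation
  \<open>t - 2 u A - 4 u^2 = 0\<close> after inserting \<open>u = 1 / (2 B)\<close> and multiplying
  by \<open>B^2\<close>.\<close>

definition A :: "complex poly" where "A = [:3 * b0, 2 * b1, b2:]"
definition B :: "complex poly" where "B = [:b1, 2 * b2, 3 * b3:]"
definition F :: "complex poly" where "F = [:0, 1:] * B\<^sup>2 - A * B - 1"

definition curve :: "complex \<Rightarrow> complex^3" where
  "curve t = (let u = 1 / (2 * poly B t) in pt u (t * u) (u\<^sup>2))"

lemma poly_F: "poly F t = t * (poly B t)\<^sup>2 - poly A t * poly B t - 1"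
  by (simp add: F_def)

text \<open>\<open>F\<close> equals \<open>-1\<close> wherever \<open>B\<close> vanishes.\<close>

lemma poly_F_root: "poly F t = 0 \<Longrightarrow> poly B t \<noteq> 0"
  by (auto simp: poly_F)

lemma Pu_homogeneous: "Pu u (t * u) = u\<^sup>2 * poly A t" and Pv_homogeneous: "Pv u (t * u) = u\<^sup>2 * poly B t"
  by (simp_all add: Pu_def Pv_def A_def B_def algebra_simps power2_eq_square)

text \<open>With \<open>t = W q / U q\<close>, the \<open>v\<close>-equation determines
  \<open>u\<close>, the third component gives \<open>q $ 3 = u^2\<close>, and the remaining equation
  is \<open>F(t) = 0\<close>.\<close>

lemma fixed_iff_curve:
  "grad pot q = q \<and> U q \<noteq> 0 \<longleftrightarrow> (\<exists>t. poly F t = 0 \<and> q = curve t)"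
proof
  assume q: "grad pot q = q \<and> U q \<noteq> 0"
  define u t where "u = U q" and "t = W q / U q"
  have W: "W q = t * u" using q by (simp add: t_def u_def)
  have "u \<noteq> 0" using q by (simp add: u_def)
  have e1: "u\<^sup>2 * poly A t + 2 * u * u\<^sup>2 = t * u / 2" and "u\<^sup>2 * poly B t = u / 2" and z: "q $ 3 = u\<^sup>2"
    using q unfolding fixed_iff W u_def[symmetric] Pu_homogeneous Pv_homogeneous by auto
  then have e2: "2 * u * poly B t = 1"
    using \<open>u \<noteq> 0\<close> by (simp add: power2_eq_square algebra_simps)
  then have "poly B t \<noteq> 0" by auto
  then have u: "u = 1 / (2 * poly B t)" using e2 by (simp add: field_simps)
  have "u * (2 * u * poly A t + 4 * u\<^sup>2) = u * t"
    using e1 by (simp add: field_simps power2_eq_square)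
  then have "2 * u * poly A t + 4 * u\<^sup>2 = t"
    using \<open>u \<noteq> 0\<close> by simp
  then have "poly F t = 0"
    unfolding u poly_F using \<open>poly B t \<noteq> 0\<close> by (simp add: field_simps power2_eq_square)
  moreover have "q = curve t"
    unfolding eq_iff_U_W by (simp add: curve_def Let_def W z u u_def[symmetric])
  ultimately show "\<exists>t. poly F t = 0 \<and> q = curve t" by blast
next
  assume "\<exists>t. poly F t = 0 \<and> q = curve t"
  then obtain t where t: "poly F t = 0" "q = curve t" by blast
  have B: "poly B t \<noteq> 0" using poly_F_root t by blast
  define u where "u = 1 / (2 * poly B t)"
  have q: "q = pt u (t * u) (u\<^sup>2)" using t by (simp add: curve_def u_def Let_def)
  have "poly A t * poly B t = t * (poly B t)\<^sup>2 - 1"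
    using t by (simp add: poly_F algebra_simps)
  then have A: "poly A t = t * poly B t - 1 / poly B t"
    using B by (simp add: field_simps power2_eq_square)
  show "grad pot q = q \<and> U q \<noteq> 0"
    unfolding q fixed_iff U_pt W_pt pt_3 Pu_homogeneous Pv_homogeneous
    unfolding A using B by (auto simp: u_def field_simps power2_eq_square)
qed

lemma inj_on_curve: "inj_on curve {t. poly F t = 0}"
proof (rule inj_onI)
  fix s t assume s: "s \<in> {t. poly F t = 0}" and t: "t \<in> {t. poly F t = 0}" and eq: "curve s = curve t"
  have "poly B s \<noteq> 0" "poly B t \<noteq> 0" using s t poly_F_root by auto
  moreover have "U (curve s) = U (curve t)" "W (curve s) = W (curve t)" using eq by simp_all
  ultimately show "s = t"
    by (simp add: curve_def Let_def)
qed

text \<open>In the coordinates \<open>u, w\<close> the first two components of a gradient are twice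
  the \<open>w\<close>- and \<open>u\<close>-derivatives, hence the swap of \<open>a\<close> and
  \<open>b\<close> and the factors 2.\<close>

lemma hessian_pot_mult_pt:
  "hessian pot (pt u v z) *v pt u' v' z' =
     (let a = (Puu u v + 2 * z) * u' + Puv u v * v' + 2 * u * z'; b = Puv u v * u' + Pvv u v * v'
      in pt (2 * b) (2 * a) (2 * u * u'))"
  unfolding eq_iff_U_W Let_def U_pt W_pt pt_3 U_def[of "_ *v _"] W_def[of "_ *v _"]
  by (simp add: matrix_vector_mult_def sum_3 hessian_pot) (simp add: pt_def field_simps)

text \<open>
  The eigenvector is the velocity of \<open>curve\<close> at \<open>t\<close>: two of the three equations \<open>V'(q) = q\<close> hold
  identically along the curve, and the third one reads \<open>F(t) = 0\<close>.
\<close>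

lemma double_root_eigenvector:
  assumes "poly F t = 0" and "poly (pderiv F) t = 0"
  shows "\<exists>w. w \<noteq> 0 \<and> hessian pot (curve t) *v w = w"
proof -
  define u where "u = 1 / (2 * poly B t)"
  \<comment> \<open>The derivative of \<open>1 / (2 B)\<close> is \<open>- B' / (2 B^2)\<close>, and
    \<open>u^2 = 1 / (4 B^2)\<close>.\<close>
  define u' where "u' = - 2 * u\<^sup>2 * poly (pderiv B) t"
  have B: "poly B t \<noteq> 0" using poly_F_root assms by blast
  then have "u \<noteq> 0" by (simp add: u_def)
  have B_u: "poly B t = 1 / (2 * u)" using B by (simp add: u_def)
  have c: "curve t = pt u (t * u) (u\<^sup>2)" by (simp add: curve_def u_def Let_def)
  let ?w = "pt u' (u + t * u') (2 * u * u')"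
  have "?w \<noteq> 0"
  proof
    assume "?w = 0"
    then have "U ?w = 0" "W ?w = 0" by (simp_all add: U_def[of 0] W_def[of 0])
    then show False using \<open>u \<noteq> 0\<close> by auto
  qed
  define X Y where "X = poly (pderiv B) t" and "Y = poly (pderiv A) t"
  have F0: "t * (poly B t)\<^sup>2 - poly A t * poly B t - 1 = 0"
    using assms(1) by (simp add: poly_F)
  have F1: "(poly B t)\<^sup>2 + 2 * t * poly B t * X - Y * poly B t - poly A t * X = 0"
    using assms(2) by (simp add: F_def X_def Y_def pderiv_diff pderiv_add pderiv_1 pderiv_mult pderiv_power power2_eq_square algebra_simps pderiv_pCons)
  have A_u: "poly A t = t / (2 * u) - 2 * u"
    using F0 \<open>u \<noteq> 0\<close> unfolding B_u by (simp add: field_simps power2_eq_square)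
  have Puv: "Puv u (t * u) = u * Y"
    by (simp add: Puv_def Y_def A_def pderiv_pCons algebra_simps)
  have Pvv: "Pvv u (t * u) = u * X"
    by (simp add: Pvv_def X_def B_def pderiv_pCons algebra_simps)
  have Puu: "Puu u (t * u) = 2 * u * poly A t - t * u * Y"
    by (simp add: Puu_def Y_def A_def pderiv_pCons algebra_simps power2_eq_square)
  \<comment> \<open>Euler's relation for the quadratic form \<open>Pv\<close>, at
    \<open>(1, t)\<close>.\<close>
  have YB: "Y = 2 * poly B t - t * X"
    by (simp add: X_def Y_def A_def B_def pderiv_pCons algebra_simps power2_eq_square)
  have u': "u' = - 2 * u\<^sup>2 * X" by (simp add: u'_def X_def)

  \<comment> \<open>This is \<open>4 u^2 F'(t)\<close> written in \<open>u\<close>, \<open>t\<close>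
    and \<open>X\<close> only, so the double root makes it vanish.\<close>
  have "4 * u * t * X + 8 * u ^ 3 * X - 1
      = 4 * u\<^sup>2 * ((poly B t)\<^sup>2 + 2 * t * poly B t * X - Y * poly B t - poly A t * X)"
    unfolding YB A_u unfolding B_u using \<open>u \<noteq> 0\<close>
    by (simp add: field_simps power2_eq_square power3_eq_cube)
  then have rel: "4 * u * t * X + 8 * u ^ 3 * X - 1 = 0" by (simp add: F1)
  have uY: "u * Y = 1 - t * u * X"
    unfolding YB B_u using \<open>u \<noteq> 0\<close> by (simp add: field_simps)
  have Puu': "Puu u (t * u) = t\<^sup>2 * u * X - 4 * u\<^sup>2"
  proof -
    have "2 * u * poly A t = t - 4 * u\<^sup>2"
      unfolding A_u using \<open>u \<noteq> 0\<close> by (simp add: field_simps power2_eq_square)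
    moreover have "t * u * Y = t * (1 - t * u * X)" using uY by (simp add: mult.assoc)
    ultimately show ?thesis unfolding Puu by (simp add: algebra_simps power2_eq_square)
  qed
  have "2 * ((Puu u (t * u) + 2 * u\<^sup>2) * u' + Puv u (t * u) * (u + t * u') + 2 * u * (2 * u * u'))
      - (u + t * u') = - u * (4 * u * t * X + 8 * u ^ 3 * X - 1)"
    unfolding Puu' Puv uY u' by (simp add: algebra_simps power2_eq_square power3_eq_cube)
  then have "2 * ((Puu u (t * u) + 2 * u\<^sup>2) * u' + Puv u (t * u) * (u + t * u') + 2 * u * (2 * u * u'))
      = u + t * u'"
    using rel by simp
  moreover have "2 * (Puv u (t * u) * u' + Pvv u (t * u) * (u + t * u')) = u'"
    unfolding Puv uY Pvv u' by (simp add: algebra_simps power2_eq_square)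
  ultimately have "hessian pot (curve t) *v ?w = ?w"
    unfolding c hessian_pot_mult_pt Let_def by (simp add: mult.assoc)
  then show ?thesis using \<open>?w \<noteq> 0\<close> by blast
qed

text \<open>Makes the degree visible: five if \<open>b3\<close> is nonzero, three with leading
  coefficient \<open>2 * b2\<^sup>2\<close> if \<open>b3 = 0\<close> and \<open>b2\<close> is
  nonzero, and at most one if both vanish.\<close>

lemma F_explicit:
  "F = [:- 3 * b0 * b1 - 1, - b1\<^sup>2 - 6 * b0 * b2, - b1 * b2 - 9 * b0 * b3, 2 * b2\<^sup>2, 9 * b2 * b3, 9 * b3\<^sup>2:]"
  by (subst poly_eq_poly_eq_iff[symmetric], rule ext)
    (simp add: poly_F A_def B_def power2_eq_square algebra_simps)

text \<open>For \<open>u = 0\<close> the equations reduce to \<open>b2 * w^2 = w / 2\<close>,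
  \<open>3 * b3 * w^2 = 0\<close> and \<open>q $ 3 = 0\<close>, and \<open>q \<noteq> 0\<close>
  forces \<open>w \<noteq> 0\<close>.\<close>

lemma null_fixed_iff:
  "grad pot q = q \<and> U q = 0 \<and> q \<noteq> 0 \<longleftrightarrow> b3 = 0 \<and> b2 \<noteq> 0 \<and> q = pt 0 (1 / (2 * b2)) 0"
proof -
  have "grad pot q = q \<and> U q = 0 \<and> q \<noteq> 0
      \<longleftrightarrow> b3 = 0 \<and> 2 * b2 * W q = 1 \<and> U q = 0 \<and> q $ 3 = 0"
    unfolding fixed_iff eq_iff_U_W[of q 0]
    by (auto simp: Pu_def Pv_def power2_eq_square U_def[of 0] W_def[of 0] algebra_simps)
  also have "2 * b2 * W q = 1 \<longleftrightarrow> b2 \<noteq> 0 \<and> W q = 1 / (2 * b2)"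
    by (cases "b2 = 0") (auto simp: field_simps)
  finally show ?thesis
    unfolding eq_iff_U_W[of q "pt _ _ _"] U_pt W_pt pt_3 by blast
qed

section \<open>Trace and determinant at the solutions\<close>

lemma curve_invariants:
  assumes "b3 = 0" "poly F t = 0"
  shows "trace (hessian pot (curve t)) - 4 = - 4 * b2 * t / poly B t"
    and "det (hessian pot (curve t) - mat 1) = poly (pderiv F) t / (poly B t)\<^sup>2"
proof -
  define \<beta> where "\<beta> = poly B t"
  have "\<beta> \<noteq> 0" using poly_F_root assms(2) by (simp add: \<beta>_def)
  have c: "curve t = pt (1 / (2 * \<beta>)) (t / (2 * \<beta>)) (1 / (4 * \<beta>\<^sup>2))"
    by (simp add: curve_def \<beta>_def Let_def power2_eq_square)
  have b1: "b1 = \<beta> - 2 * b2 * t" unfolding \<beta>_def B_def using assms(1) by simp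
  show "trace (hessian pot (curve t)) - 4 = - 4 * b2 * t / poly B t"
    unfolding \<beta>_def[symmetric] using \<open>\<beta> \<noteq> 0\<close>
    by (simp add: c trace_hessian_pot Puv_def field_simps) (simp add: b1 algebra_simps)
  have "\<beta> * (t * \<beta> - poly A t) = 1"
    using assms(2) by (simp add: poly_F \<beta>_def algebra_simps power2_eq_square)
  \<comment> \<open>The equation \<open>F(t) = 0\<close> makes \<open>1 / \<beta>\<close> polynomial
    in \<open>t\<close>, which lets the numerator of the determinant be recognised as
    \<open>F'(t)\<close>.\<close>
  then have inv: "1 / \<beta> = t * \<beta> - poly A t"
    using \<open>\<beta> \<noteq> 0\<close> by (simp add: field_simps)
  have Puv: "2 * Puv (1 / (2 * \<beta>)) (t / (2 * \<beta>)) - 1 = b1 / \<beta>"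
    using \<open>\<beta> \<noteq> 0\<close> by (simp add: Puv_def field_simps) (simp add: b1 algebra_simps)
  have "det (hessian pot (curve t) - mat 1)
      = (4 * b2 * (3 * b0 + b1 * t) + 6 * b2 * (1 / \<beta>) - b1\<^sup>2) / \<beta>\<^sup>2"
    unfolding c det_hessian_pot U_pt W_pt pt_3 Puv unfolding Pvv_def Puu_def
    using \<open>\<beta> \<noteq> 0\<close> assms(1) by (simp add: field_simps power2_eq_square)
  also have "4 * b2 * (3 * b0 + b1 * t) + 6 * b2 * (1 / \<beta>) - b1\<^sup>2 = poly (pderiv F) t"
    unfolding inv unfolding F_explicit A_def \<beta>_def B_def using assms(1)
    by (simp add: pderiv_pCons algebra_simps power2_eq_square)
  finally show "det (hessian pot (curve t) - mat 1) = poly (pderiv F) t / (poly B t)\<^sup>2"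
    by (simp add: \<beta>_def)
qed

lemma null_point_invariants:
  assumes "b3 = 0" "b2 \<noteq> 0"
  shows "trace (hessian pot (pt 0 (1 / (2 * b2)) 0)) = 4"
    and "det (hessian pot (pt 0 (1 / (2 * b2)) 0) - mat 1) = - 1"
  unfolding trace_hessian_pot det_hessian_pot U_pt W_pt pt_3 Puv_def Pvv_def Puu_def
  using assms by simp_all

lemma fixed_points:
  "{q. grad pot q = q \<and> q \<noteq> 0} =
     curve ` {t. poly F t = 0} \<union> (if b3 = 0 \<and> b2 \<noteq> 0 then {pt 0 (1 / (2 * b2)) 0} else {})"
proof -
  have "{q. grad pot q = q \<and> q \<noteq> 0}
      = {q. grad pot q = q \<and> U q \<noteq> 0} \<union> {q. grad pot q = q \<and> U q = 0 \<and> q \<noteq> 0}"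
    by (auto simp: U_def)
  then show ?thesis unfolding fixed_iff_curve null_fixed_iff by auto
qed

lemma null_point_not_on_curve: "pt 0 v z \<notin> curve ` {t. poly F t = 0}"
proof
  assume "pt 0 v z \<in> curve ` {t. poly F t = 0}"
  then have "U (pt 0 v z) \<noteq> 0" using fixed_iff_curve by blast
  then show False by simp
qed

section \<open>Counting solutions and summing over them\<close>

lemma four_simple_points:
  assumes card: "card {q. grad pot q = q \<and> q \<noteq> 0} = 4"
    and simple: "\<And>q. grad pot q = q \<Longrightarrow> q \<noteq> 0 \<Longrightarrow> simple_darboux pot q"
  shows "b3 = 0" and "b2 \<noteq> 0" and "card {t. poly F t = 0} = 3"
proof -
  show "b3 = 0"
  proof (rule ccontr)
    assume "b3 \<noteq> 0"
    then have "card {t. poly F t = 0} = 4"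
      using card card_image[OF inj_on_curve] by (simp add: fixed_points)
    moreover have "degree F = 5" using \<open>b3 \<noteq> 0\<close> by (simp add: F_explicit)
    \<comment> \<open>Five roots with multiplicity, but only four distinct ones.\<close>
    ultimately obtain t where t: "poly F t = 0" "poly (pderiv F) t = 0"
      using card_roots_eq_degree[of F] by force
    then obtain w where w: "hessian pot (curve t) *v w = w" "w \<noteq> 0"
      using double_root_eigenvector by blast
    have "curve t \<in> {q. grad pot q = q \<and> q \<noteq> 0}"
      unfolding fixed_points using t by blast
    then have "grad pot (curve t) = curve t" "simple_darboux pot (curve t)"
      using simple by auto
    then show False
      using not_simple_darboux[OF partial_deriv_pot_scale DERIV_partial_deriv_pot _ w] by blast
  qed
  show "b2 \<noteq> 0"
  proof
    assume "b2 = 0"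
    \<comment> \<open>The surviving coefficients \<open>- 3 * b0 * b1 - 1\<close> and
      \<open>- b1\<^sup>2\<close> cannot both vanish.\<close>
    then have "F \<noteq> 0" "degree F \<le> 1"
      unfolding F_explicit using \<open>b3 = 0\<close> by auto
    then have "card {t. poly F t = 0} \<le> 1"
      using card_poly_roots_bound[of F] by simp
    then show False
      using card card_image[OF inj_on_curve] \<open>b2 = 0\<close> unfolding fixed_points by simp
  qed
  have "F \<noteq> 0" using \<open>b2 \<noteq> 0\<close> by (simp add: F_explicit)
  show "card {t. poly F t = 0} = 3"
    using card card_image[OF inj_on_curve] \<open>b3 = 0\<close> \<open>b2 \<noteq> 0\<close> poly_roots_finite[OF \<open>F \<noteq> 0\<close>]
      null_point_not_on_curve[of "1 / (2 * b2)" 0]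
    unfolding fixed_points by simp
qed

lemma F_factorisation:
  assumes "b3 = 0" and "b2 \<noteq> 0" and "card {t. poly F t = 0} = 3"
  obtains r s t where "r \<noteq> s" "r \<noteq> t" "s \<noteq> t" "{t. poly F t = 0} = {r, s, t}"
    "F = smult (2 * b2\<^sup>2) ([:- r, 1:] * [:- s, 1:] * [:- t, 1:])"
proof -
  obtain r s t where rst: "{t. poly F t = 0} = {r, s, t}" "r \<noteq> s" "r \<noteq> t" "s \<noteq> t"
    using assms(3) unfolding card_3_iff by auto
  have "F \<noteq> 0" "degree F = 3" and lead: "lead_coeff F = 2 * b2\<^sup>2"
    unfolding F_explicit using assms by (simp_all add: numeral_2_eq_2 numeral_3_eq_3)
  have "set_mset (proots F) = {r, s, t}"
    using rst(1) \<open>F \<noteq> 0\<close> by simp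
  moreover have "size (proots F) = 3"
    by (simp add: size_proots_complex \<open>degree F = 3\<close>)
  moreover have "mset_set {r, s, t} = {#r, s, t#}"
    using rst by simp
  \<comment> \<open>Three distinct roots already exhaust a multiset of size three, so each has
    multiplicity one.\<close>
  ultimately have "proots F = {#r, s, t#}"
    using mset_set_set_mset_msubset[of "proots F"] mset_subset_size[of "{#r, s, t#}" "proots F"]
    by (auto simp: subset_mset.le_less)
  then have "F = smult (2 * b2\<^sup>2) ([:- r, 1:] * [:- s, 1:] * [:- t, 1:])"
    using complex_poly_decompose_multiset[of F] lead by (simp add: mult.assoc del: mult_pCons_left mult_pCons_right)
  then show ?thesis using that rst by blast
qed

lemma spectrum_sums:
  fixes d :: "nat \<Rightarrow> complex^3"
  assumes bij: "bij_betw d {1..4} {q. grad pot q = q \<and> q \<noteq> 0}"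
    and simple: "\<And>i. i \<in> {1..4} \<Longrightarrow> simple_darboux pot (d i)"
  defines "\<pi> \<equiv> \<lambda>i. det (hessian pot (d i) - mat 1)" and "\<sigma> \<equiv> \<lambda>i. trace (hessian pot (d i)) - 4"
  shows "(\<Sum>i = 1..4. 1 / \<pi> i) = 1" and "(\<Sum>i = 1..4. \<sigma> i / \<pi> i) = - 4"
    and "(\<Sum>i = 1..4. (\<sigma> i)\<^sup>2 / \<pi> i) = 8"
proof -
  have card: "card {q. grad pot q = q \<and> q \<noteq> 0} = 4"
    using bij_betw_same_card[OF bij] by simp
  have simple': "simple_darboux pot q" if "grad pot q = q" "q \<noteq> 0" for q
  proof -
    have "q \<in> d ` {1..4}" using bij that unfolding bij_betw_def by blast
    then show ?thesis using simple by blast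
  qed
  note b = four_simple_points[OF card simple']
  have "b2 \<noteq> 0" "b3 = 0" using b by auto
  obtain r s t where distinct: "r \<noteq> s" "r \<noteq> t" "s \<noteq> t" and roots: "{t. poly F t = 0} = {r, s, t}"
    and F: "F = smult (2 * b2\<^sup>2) ([:- r, 1:] * [:- s, 1:] * [:- t, 1:])"
    using F_factorisation[OF b] by blast
  define n where "n = pt 0 (1 / (2 * b2)) 0"
  have "n \<notin> curve ` {r, s, t}"
    unfolding n_def roots[symmetric] by (rule null_point_not_on_curve)
  have inj: "inj_on curve {r, s, t}" using inj_on_curve roots by simp
  have points: "{q. grad pot q = q \<and> q \<noteq> 0} = insert n (curve ` {r, s, t})"
    unfolding fixed_points roots n_def using \<open>b2 \<noteq> 0\<close> \<open>b3 = 0\<close> by simp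
  have split: "(\<Sum>i = 1..4. f (d i)) = f n + (f (curve r) + f (curve s) + f (curve t))"
    for f :: "complex^3 \<Rightarrow> complex"
  proof -
    have "(\<Sum>i = 1..4. f (d i)) = sum f (insert n (curve ` {r, s, t}))"
      using sum.reindex_bij_betw[OF bij, of f] unfolding points .
    also have "\<dots> = f n + sum f (curve ` {r, s, t})"
      using \<open>n \<notin> _\<close> by (subst sum.insert) auto
    also have "sum f (curve ` {r, s, t}) = f (curve r) + f (curve s) + f (curve t)"
      using distinct by (subst sum.reindex[OF inj]) (simp add: add.assoc)
    finally show ?thesis .
  qed
  define k where "k = 2 * b2\<^sup>2"
  have "k \<noteq> 0" using \<open>b2 \<noteq> 0\<close> by (simp add: k_def)
  have F': "poly (pderiv F) r = k * (r - s) * (r - t)" "poly (pderiv F) s = k * (s - r) * (s - t)"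
    "poly (pderiv F) t = k * (t - r) * (t - s)"
    unfolding F k_def by (simp_all add: pderiv_pCons algebra_simps power2_eq_square)
  have B: "poly B x = b1 + 2 * b2 * x" for x
    unfolding B_def using \<open>b3 = 0\<close> by simp
  have root: "poly F x = 0" "poly B x \<noteq> 0" if "x \<in> {r, s, t}" for x
    using that roots poly_F_root by auto
  note null = null_point_invariants[OF \<open>b3 = 0\<close> \<open>b2 \<noteq> 0\<close>, folded n_def]
  note inv = curve_invariants[OF \<open>b3 = 0\<close> root(1)]
  \<comment> \<open>The denominator \<open>B^2\<close> of the determinant cancels against the trace
    terms, leaving numerators of degree at most two over \<open>F'\<close>.\<close>
  have 1: "1 / det (hessian pot (curve x) - mat 1) = (b1 + 2 * b2 * x)\<^sup>2 / poly (pderiv F) x"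
    and 2: "(trace (hessian pot (curve x)) - 4) / det (hessian pot (curve x) - mat 1)
      = (- 4 * b2 * x * (b1 + 2 * b2 * x)) / poly (pderiv F) x"
    and 3: "(trace (hessian pot (curve x)) - 4)\<^sup>2 / det (hessian pot (curve x) - mat 1)
      = (- 4 * b2 * x)\<^sup>2 / poly (pderiv F) x" if "x \<in> {r, s, t}" for x
    using root(2)[OF that] unfolding inv[OF that] B[symmetric]
    by (simp_all add: power2_eq_square field_simps)
  \<comment> \<open>The point \<open>n\<close> contributes \<open>-1\<close> here and
    \<open>0\<close> to the other two sums. With \<open>k = 2 * b2\<^sup>2\<close> the three root
    sums are \<open>2\<close>, \<open>-4\<close> and \<open>8\<close>.\<close>
  have "(\<Sum>i = 1..4. 1 / \<pi> i) = - 1 + 4 * b2\<^sup>2 / k"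
    unfolding \<pi>_def split[of "\<lambda>q. 1 / det (hessian pot q - mat 1)"] null
    using euler_jacobi_3[OF \<open>k \<noteq> 0\<close> distinct, of "\<lambda>x. (b1 + 2 * b2 * x)\<^sup>2" "b1\<^sup>2" "4 * b1 * b2" "4 * b2\<^sup>2"]
    by (simp add: 1 F' power2_eq_square algebra_simps)
  then show "(\<Sum>i = 1..4. 1 / \<pi> i) = 1"
    using \<open>b2 \<noteq> 0\<close> by (simp add: k_def)
  have "(\<Sum>i = 1..4. \<sigma> i / \<pi> i) = - 8 * b2\<^sup>2 / k"
    unfolding \<pi>_def \<sigma>_def split[of "\<lambda>q. (trace (hessian pot q) - 4) / det (hessian pot q - mat 1)"] null
    using euler_jacobi_3[OF \<open>k \<noteq> 0\<close> distinct, of "\<lambda>x. - 4 * b2 * x * (b1 + 2 * b2 * x)" 0 "- 4 * b1 * b2" "- 8 * b2\<^sup>2"]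
    by (simp add: 2 F' power2_eq_square algebra_simps)
  then show "(\<Sum>i = 1..4. \<sigma> i / \<pi> i) = - 4"
    using \<open>b2 \<noteq> 0\<close> by (simp add: k_def)
  have "(- 4 * b2 * x)\<^sup>2 = 0 + 0 * x + 16 * b2\<^sup>2 * x\<^sup>2" for x
    by (simp add: power_mult_distrib)
  note euler_jacobi_3[OF \<open>k \<noteq> 0\<close> distinct this]
  then have "(\<Sum>i = 1..4. (\<sigma> i)\<^sup>2 / \<pi> i) = 16 * b2\<^sup>2 / k"
    unfolding \<pi>_def \<sigma>_def split[of "\<lambda>q. (trace (hessian pot q) - 4)\<^sup>2 / det (hessian pot q - mat 1)"] null
    by (simp add: 3 F')
  then show "(\<Sum>i = 1..4. (\<sigma> i)\<^sup>2 / \<pi> i) = 8"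
    using \<open>b2 \<noteq> 0\<close> by (simp add: k_def)
qed

end

theorem lemma4p4:
  fixes a1 a2 a4 a5 :: complex
    and V :: "complex^3 \<Rightarrow> complex"
    and d :: "nat \<Rightarrow> complex^3"
    and \<Lambda>1 \<Lambda>2 :: "nat \<Rightarrow> complex"
  assumes V: "V = (\<lambda>q. a1 * (q $ 1) ^ 3 + a2 * (q $ 1)\<^sup>2 * q $ 2 + a4 * q $ 1 * (q $ 2)\<^sup>2
                     + a5 * (q $ 2) ^ 3 + (q $ 1 + \<i> * q $ 2)\<^sup>2 * q $ 3)"
    and four: "bij_betw (\<lambda>i. proj_point (d i)) {1..4} (proper_darboux_points V)"
    and normalised: "\<And>i. i \<in> {1..4} \<Longrightarrow> grad V (d i) = d i"
    and simple: "\<And>i. i \<in> {1..4} \<Longrightarrow> simple_darboux V (d i)"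
    and spectrum: "\<And>i. i \<in> {1..4} \<Longrightarrow> darboux_spectrum V (d i) = {#\<Lambda>1 i, \<Lambda>2 i#}"
  shows "(\<Sum>i = 1..4. 1 / (\<Lambda>1 i * \<Lambda>2 i)) = 1
       \<and> (\<Sum>i = 1..4. (\<Lambda>1 i + \<Lambda>2 i) / (\<Lambda>1 i * \<Lambda>2 i)) = - 4
       \<and> (\<Sum>i = 1..4. (\<Lambda>1 i + \<Lambda>2 i)\<^sup>2 / (\<Lambda>1 i * \<Lambda>2 i)) = 8"
proof -
  \<comment> \<open>The coefficients come from substituting \<open>q\<^sub>1 = (u + w) / 2\<close>
    and \<open>q\<^sub>2 = (u - w) / (2 \<i>)\<close>.\<close>
  interpret null_cubic "(a1 - \<i> * a2 - a4 + \<i> * a5) / 8" "(3 * a1 - \<i> * a2 + a4 - 3 * \<i> * a5) / 8"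
    "(3 * a1 + \<i> * a2 + a4 + 3 * \<i> * a5) / 8" "(a1 + \<i> * a2 - a4 - \<i> * a5) / 8" .
  have "V q = pot q" for q
  proof -
    have "a1 * x ^ 3 + a2 * x\<^sup>2 * y + a4 * x * y\<^sup>2 + a5 * y ^ 3 = P (x + \<i> * y) (x - \<i> * y)" for x y
    proof -
      have eq: "8 * P (x + \<i> * y) (x - \<i> * y) = 8 * (a1 * x ^ 3 + a2 * x\<^sup>2 * y + a4 * x * y\<^sup>2 + a5 * y ^ 3)"
        unfolding P_def by (simp add: field_simps power2_eq_square power3_eq_cube)
      show ?thesis
        by (rule mult_left_cancel[THEN iffD1, OF _ eq, symmetric]) simp
    qed
    then show ?thesis by (simp add: V pot_def U_def W_def)
  qed
  then have V: "V = pot" by blast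
  have bij: "bij_betw d {1..4} {q. grad pot q = q \<and> q \<noteq> 0}"
    using bij_betw_normalised[OF partial_deriv_pot_scale] four normalised unfolding V by blast
  have "\<Lambda>1 i * \<Lambda>2 i = det (hessian pot (d i) - mat 1)"
    "\<Lambda>1 i + \<Lambda>2 i = trace (hessian pot (d i)) - 4" if "i \<in> {1..4}" for i
    using darboux_spectrum_invariants spectrum[OF that] unfolding V by blast+
  then show ?thesis
    using spectrum_sums[OF bij] simple unfolding V by simp
qed

end
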